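(* Let $n\ge1$ be an integer. For positive integers $a$, $b$, and $c$, we have \[ \operatorname{vol}\mathcal F_{\mathrm{Car}_{n+2}}(a,b,c^{n-1})=C_{n-1}\,a^{n-1}(a+nb)\bigl(a+b+(n-1)c\bigr)^{n-2}, \] where $C_m=\frac1{m+1}\binom{2m}{m}$ is the $m$th Catalan number (and for $n=1$ the last factor is read as $(a+b)^{-1}$).
   Context: Flow polytope: let $G$ be a connected directed graph on $\{1,\dots,N+1\}$ with $M$ edges, each of the form $(i,j)$ with $i<j$, with edge set $E$, and let $\mathbf a=(a_1,\dots,a_N)\in\mathbb Z^N$. The flow polytope $\mathcal F_G(\mathbf a)$ is the set of all $(b_e)_{e\in E}\in\mathbb R_{\ge0}^M$ such that $\sum_{e=(i,j)\in E} b_e(\mathbf e_i-\mathbf e_j)=(a_1,\dots,a_N,-\sum_{i=1}^N a_i)$, where $\mathbf e_i$ is the $i$th standard basis vector of $\mathbb R^{N+1}$. Its normalized volume $\operatorname{vol}\mathcal F_G(\mathbf a)$ is $(M-N)!$ times its $(M-N)$-dimensional volume in the affine space cut out by these equations, scaled so that a fundamental parallelepiped of the lattice $\{b\in\mathbb Z^M:\sum b_e(\mathbf e_i-\mathbf e_j)=0\}$ has volume $1$. The caracol graph $\mathrm{Car}_{n+2}$ has vertex set $\{1,\dots,n+2\}$ and edge set $\{(i,i+1):1\le i\le n+1\}\cup\{(1,i):3\le i\le n+1\}\cup\{(i,n+2):2\le i\le n\}$. In a net flow vector, $c^{j}$ denotes the sequence $c,\dots,c$ of $j$ copies of $c$;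 thus $(a,b,c^{n-1})$ has $n+1$ entries. *)

theory Defs
  imports "HOL-Analysis.Analysis"
begin

text \<open>
  A directed graph on the vertices \<open>1, \<dots>, N + 1\<close> is given by its finite set \<open>E\<close> of edges \<open>(i, j)\<close>,
  \<open>i < j\<close>. The space \<open>\<real>\<^sup>E\<close> is modelled by the functions that vanish outside \<open>E\<close>. A net flow vector
  \<open>(a\<^sub>1, \<dots>, a\<^sub>N)\<close> is a list, so that \<open>N\<close> is its length.
\<close>

definition edge_space :: "(nat \<times> nat) set \<Rightarrow> (nat \<times> nat \<Rightarrow> real) set" where
  "edge_space E = {x. \<forall>e. e \<notin> E \<longrightarrow> x e = 0}"

text \<open>The \<open>k\<close>-th coordinate of the sum of \<open>x\<^sub>e (e\<^sub>i - e\<^sub>j)\<close> over the edges \<open>e = (i, j)\<close>.\<close>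

definition net_flow :: "(nat \<times> nat) set \<Rightarrow> (nat \<times> nat \<Rightarrow> real) \<Rightarrow> nat \<Rightarrow> real" where
  "net_flow E x k = (\<Sum>(i, j)\<in>E. x (i, j) * (of_bool (i = k) - of_bool (j = k)))"

definition flow_space :: "(nat \<times> nat) set \<Rightarrow> int list \<Rightarrow> (nat \<times> nat \<Rightarrow> real) set" where
  "flow_space E a = {x \<in> edge_space E. \<forall>k\<in>{1..length a + 1}.
     net_flow E x k = real_of_int ((a @ [- sum_list a]) ! (k - 1))}"

definition flow_polytope :: "(nat \<times> nat) set \<Rightarrow> int list \<Rightarrow> (nat \<times> nat \<Rightarrow> real) set" where
  "flow_polytope E a = {x \<in> flow_space E a. \<forall>e\<in>E. 0 \<le> x e}"

definition flow_lattice :: "(nat \<times> nat) set \<Rightarrow> nat \<Rightarrow> (nat \<times> nat \<Rightarrow> real) set" where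
  "flow_lattice E N = {x \<in> flow_space E (replicate N 0). \<forall>e\<in>E. x e \<in> \<int>}"

text \<open>For a connected graph the lattice has rank \<open>card E - N\<close>; a basis is indexed from \<open>0\<close>, and the
  values of \<open>v\<close> at other indices are irrelevant.\<close>

definition is_flow_lattice_basis ::
    "(nat \<times> nat) set \<Rightarrow> nat \<Rightarrow> (nat \<Rightarrow> nat \<times> nat \<Rightarrow> real) \<Rightarrow> bool" where
  "is_flow_lattice_basis E N v \<longleftrightarrow>
     (\<forall>i < card E - N. v i \<in> flow_lattice E N) \<and>
     (\<forall>x \<in> flow_lattice E N. \<exists>!c. c \<in> {..<card E - N} \<rightarrow>\<^sub>E (UNIV :: int set) \<and>
        x = (\<lambda>e. \<Sum>i < card E - N. real_of_int (c i) * v i e))"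

text \<open>
  The volume on the affine space \<open>flow_space E a\<close> for which a fundamental parallelepiped of the
  lattice has volume 1 is Lebesgue measure in the coordinates given by a lattice basis \<open>v\<close> and an
  origin \<open>p\<close>. It depends neither on \<open>v\<close> (two bases differ by an integer matrix of determinant
  1 or -1) nor on \<open>p\<close>. In dimension 0 the product measure is the unit mass on a single point.
\<close>

definition lattice_volume ::
    "(nat \<times> nat) set \<Rightarrow> int list \<Rightarrow> (nat \<times> nat \<Rightarrow> real) set \<Rightarrow> real" where
  "lattice_volume E a S =
     (let d = card E - length a;
          v = (SOME v. is_flow_lattice_basis E (length a) v);
          p = (SOME p. p \<in> flow_space E a)
      in measure (PiM {..<d} (\<lambda>_. lborel))
           {t \<in> {..<d} \<rightarrow>\<^sub>E UNIV. (\<lambda>e. p e + (\<Sum>i<d. t i * v i e)) \<in> S})"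

definition flow_polytope_vol :: "(nat \<times> nat) set \<Rightarrow> int list \<Rightarrow> real" where
  "flow_polytope_vol E a =
     fact (card E - length a) * lattice_volume E a (flow_polytope E a)"

text \<open>The edges of the caracol graph on the \<open>n + 2\<close> vertices \<open>1, \<dots>, n + 2\<close>.\<close>

definition caracol :: "nat \<Rightarrow> (nat \<times> nat) set" where
  "caracol n = {(i, i + 1) | i. 1 \<le> i \<and> i \<le> n + 1}
             \<union> {(1, i) | i. 3 \<le> i \<and> i \<le> n + 1}
             \<union> {(i, n + 2) | i. 2 \<le> i \<and> i \<le> n}"

definition catalan :: "nat \<Rightarrow> real" where
  "catalan m = 1 / (real m + 1) * real ((2 * m) choose m)"

end

theory Submission
  imports Defs
begin

text \<open>
  A flow on the caracol graph is determined by its values \<open>x\<^sub>k\<close> on the edges \<open>(1, k)\<close> and \<open>p\<^sub>k\<close> on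
  the edges \<open>(k, k + 1)\<close>, \<open>2 \<le> k \<le> n\<close>. In these coordinates the polytope is swept out vertex by
  vertex: if \<open>s\<close> is the flow still to leave the vertex 1 and \<open>q\<close> the flow entering the current vertex from
  elsewhere, the volume with \<open>m + 1\<close> vertices left is
  \<open>V\<^sub>m\<^sub>+\<^sub>1(s, q) = \<integral>\<^sub>0\<^sup>s \<integral>\<^sub>0\<^sup>q\<^sup>+\<^sup>x V\<^sub>m(s - x, p + c) dp dx\<close>, which is solved by
  \<open>V\<^sub>m(s, q) = s\<^sup>m (s + (m + 1) q) (s + q + m c)\<^sup>m\<^sup>-\<^sup>1 / (m! (m + 1)!)\<close>.

  That these coordinates compute the volume for an arbitrary lattice basis amounts to unimodular maps
  preserving Lebesgue measure. By uniqueness of translation-invariant measures such a map scales the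
  measure by a constant, and the constant is 1 because the unit cube and its preimage are both
  fundamental domains of the integer lattice.
\<close>

section \<open>Lebesgue measure under unimodular maps\<close>

lemma sigma_finite_PiM_lborel:
  "finite I \<Longrightarrow> sigma_finite_measure (PiM I (\<lambda>_. lborel :: real measure))"
  by (intro product_sigma_finite.sigma_finite product_sigma_finite.intro lborel.sigma_finite_measure_axioms)

text \<open>A product measure is determined by its values on boxes, and a translated box is again a
  box whose sides have unchanged length.\<close>

lemma distr_PiM_lborel_translation:
  fixes r :: "'i \<Rightarrow> real"
  assumes "finite I"
  shows "distr (PiM I (\<lambda>_. lborel)) (PiM I (\<lambda>_. lborel)) (\<lambda>t. \<lambda>i\<in>I. t i + r i) = PiM I (\<lambda>_. lborel)"
    (is "?P = ?M")
proof (rule product_sigma_finite.PiM_eqI)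
  show "product_sigma_finite (\<lambda>_. lborel :: real measure)"
    by (simp add: product_sigma_finite_def lborel.sigma_finite_measure_axioms)
  show "finite I" "sets ?P = sets ?M" using assms by simp_all
  fix A :: "'i \<Rightarrow> real set" assume A: "\<And>i. i \<in> I \<Longrightarrow> A i \<in> sets lborel"
  have meas: "(\<lambda>t. \<lambda>i\<in>I. t i + r i) \<in> ?M \<rightarrow>\<^sub>M ?M"
    by measurable
  have pre: "(\<lambda>t. \<lambda>i\<in>I. t i + r i) -` (Pi\<^sub>E I A) \<inter> space ?M = Pi\<^sub>E I (\<lambda>i. (\<lambda>x. x + r i) -` A i)"
    by (auto simp: space_PiM PiE_iff)
  have Ai: "(\<lambda>x. x + r i) -` A i \<in> sets lborel" if "i \<in> I" for i
    using measurable_sets[of "\<lambda>x. x + r i" borel borel "A i"] A[OF that] by simp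
  have eq: "emeasure lborel ((\<lambda>x. x + r i) -` A i) = emeasure lborel (A i)" if "i \<in> I" for i
    using emeasure_distr[of "\<lambda>x. x + r i" lborel borel "A i"] A[OF that]
      lborel_distr_plus[of "r i"] by (simp add: add.commute[of _ "r i"])
  have "emeasure ?P (Pi\<^sub>E I A) = emeasure ?M (Pi\<^sub>E I (\<lambda>i. (\<lambda>x. x + r i) -` A i))"
    using A assms by (subst emeasure_distr[OF meas]) (auto simp: pre intro!: sets_PiM_I_finite)
  also have "\<dots> = (\<Prod>i\<in>I. emeasure lborel (A i))"
    using Ai eq assms
    by (subst product_sigma_finite.emeasure_PiM)
       (auto simp: product_sigma_finite_def lborel.sigma_finite_measure_axioms intro!: prod.cong)
  finally show "emeasure ?P (Pi\<^sub>E I A) = (\<Prod>i\<in>I. emeasure lborel (A i))" .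
qed

lemma nn_integral_PiM_lborel_translation:
  fixes r :: "'i \<Rightarrow> real"
  assumes "finite I" and f: "f \<in> borel_measurable (PiM I (\<lambda>_. lborel))"
  shows "(\<integral>\<^sup>+t. f (\<lambda>i\<in>I. t i + r i) \<partial>PiM I (\<lambda>_. lborel)) = (\<integral>\<^sup>+t. f t \<partial>PiM I (\<lambda>_. lborel))"
proof -
  have "(\<integral>\<^sup>+t. f t \<partial>PiM I (\<lambda>_. lborel))
      = (\<integral>\<^sup>+t. f t \<partial>distr (PiM I (\<lambda>_. lborel)) (PiM I (\<lambda>_. lborel)) (\<lambda>t. \<lambda>i\<in>I. t i + r i))"
    using distr_PiM_lborel_translation[OF assms(1), of r] by simp
  also have "\<dots> = (\<integral>\<^sup>+t. f (\<lambda>i\<in>I. t i + r i) \<partial>PiM I (\<lambda>_. lborel))"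
    by (rule nn_integral_distr) (use f in measurable)
  finally show ?thesis ..
qed

text \<open>The half-open unit cube meets each coset of the integer lattice in exactly one point,
  found coordinatewise with the floor. The sign \<open>s = -1\<close> serves to cut space into
  translates of the cube, \<open>s = 1\<close> to collect the shifts of an image point.\<close>

lemma nn_integral_integer_translates:
  fixes x :: "'i \<Rightarrow> real"
  assumes "finite I" and s: "s = 1 \<or> s = -1"
  shows "(\<integral>\<^sup>+z. indicator (I \<rightarrow>\<^sub>E {0..<1}) (\<lambda>i\<in>I. x i + s * z i) \<partial>count_space (I \<rightarrow>\<^sub>E \<int>)) = 1"
proof -
  \<comment> \<open>The only lattice point that can contribute: \<open>s * z0 i\<close> is minus the
    integer part of \<open>x i\<close>, since \<open>s * s = 1\<close>.\<close>
  define z0 where "z0 = (\<lambda>i\<in>I. - s * of_int \<lfloor>x i\<rfloor>)"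
  have z0: "z0 \<in> I \<rightarrow>\<^sub>E \<int>"
    using s by (auto simp: z0_def)
  have "indicator (I \<rightarrow>\<^sub>E {0..<1}) (\<lambda>i\<in>I. x i + s * z i) = (indicator {z0} z :: ennreal)"
    if z: "z \<in> I \<rightarrow>\<^sub>E \<int>" for z
  proof -
    have 1: "x i + s * z i \<in> {0..<1} \<longleftrightarrow> z i = z0 i" if "i \<in> I" for i
    proof -
      obtain k where k: "z i = of_int k"
        using z \<open>i \<in> I\<close> by (auto elim!: PiE_E Ints_cases)
      have "x i + s * k \<in> {0..<1} \<longleftrightarrow> k = - s * of_int \<lfloor>x i\<rfloor>"
      proof (cases "s = 1")
        case True
        have "x i + k \<in> {0..<1} \<longleftrightarrow> \<lfloor>x i\<rfloor> = - k"
          by (simp add: floor_eq_iff) linarith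
        also have "\<dots> \<longleftrightarrow> real_of_int k = - of_int \<lfloor>x i\<rfloor>"
          by linarith
        finally show ?thesis using True by simp
      next
        case False
        have "x i - k \<in> {0..<1} \<longleftrightarrow> \<lfloor>x i\<rfloor> = k"
          by (simp add: floor_eq_iff) linarith
        also have "\<dots> \<longleftrightarrow> real_of_int k = of_int \<lfloor>x i\<rfloor>"
          by linarith
        finally show ?thesis using False s by simp
      qed
      then show ?thesis
        using \<open>i \<in> I\<close> by (simp add: k z0_def)
    qed
    have "z = z0 \<longleftrightarrow> (\<forall>i\<in>I. z i = z0 i)"
      using z z0 by (auto intro: PiE_ext)
    with 1 show ?thesis by (auto simp: indicator_def PiE_iff)
  qed
  then have "(\<integral>\<^sup>+z. indicator (I \<rightarrow>\<^sub>E {0..<1}) (\<lambda>i\<in>I. x i + s * z i) \<partial>count_space (I \<rightarrow>\<^sub>E \<int>))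
      = (\<integral>\<^sup>+z. indicator {z0} z \<partial>count_space (I \<rightarrow>\<^sub>E \<int>))"
    by (intro nn_integral_cong) auto
  also have "\<dots> = 1"
    using z0 by simp
  finally show ?thesis .
qed

text \<open>Unimodularity is expressed by additivity, surjectivity and a bijection on the integer
  points. A change of lattice basis supplies exactly this, so no matrix or determinant
  enters.\<close>

lemma emeasure_PiM_lborel_unimodular:
  fixes I :: "'i set" and T :: "('i \<Rightarrow> real) \<Rightarrow> 'i \<Rightarrow> real"
  defines "L \<equiv> PiM I (\<lambda>_. lborel :: real measure)"
  assumes fin: "finite I"
    and T: "T \<in> L \<rightarrow>\<^sub>M L"
    and add: "\<And>x y. x \<in> I \<rightarrow>\<^sub>E UNIV \<Longrightarrow> y \<in> I \<rightarrow>\<^sub>E UNIV \<Longrightarrow>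
      T (\<lambda>i\<in>I. x i + y i) = (\<lambda>i\<in>I. T x i + T y i)"
    and surj: "I \<rightarrow>\<^sub>E UNIV \<subseteq> T ` (I \<rightarrow>\<^sub>E UNIV)"
    and bij: "bij_betw T (I \<rightarrow>\<^sub>E \<int>) (I \<rightarrow>\<^sub>E \<int>)"
    and D: "D \<in> sets L"
  shows "emeasure L (T -` D \<inter> space L) = emeasure L D"
proof -
  define Q :: "('i \<Rightarrow> real) set" where "Q = I \<rightarrow>\<^sub>E {0..<1}"
  have space_L: "space L = I \<rightarrow>\<^sub>E UNIV"
    by (simp add: L_def space_PiM)
  note [measurable] = T D
  have Q [measurable]: "Q \<in> sets L"
    unfolding Q_def L_def by (intro sets_PiM_I_finite fin) auto
  have T_in: "T x \<in> I \<rightarrow>\<^sub>E UNIV" if "x \<in> I \<rightarrow>\<^sub>E UNIV" for x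
    using measurable_space[OF T] that by (simp add: space_L)
  \<comment> \<open>The sum \<open>x + y\<close> and the difference \<open>x - y\<close> in one
    notation. The restriction to \<open>I\<close> keeps the result in the space of extensional
    functions; \<open>o0\<close> below is the zero vector of that space.\<close>
  define P where "P s x y = (\<lambda>i\<in>I. x i + s * y i)" for s :: real and x y :: "'i \<Rightarrow> real"
  have pair: "(\<lambda>p. P s (fst p) (snd p)) \<in> L \<Otimes>\<^sub>M L \<rightarrow>\<^sub>M L" for s :: real
    unfolding L_def P_def by measurable
  have [measurable]: "(\<lambda>x. P s (f x) (g x)) \<in> K \<rightarrow>\<^sub>M L"
    if [measurable]: "f \<in> K \<rightarrow>\<^sub>M L" "g \<in> K \<rightarrow>\<^sub>M L" for K :: "'k measure" and f g and s :: real
    using measurable_compose[OF measurable_Pair[OF that] pair, of s] by simp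
  have P_commute: "P 1 x y = P 1 y x" for x y
    by (simp add: P_def add.commute)
  define o0 where "o0 = (\<lambda>i\<in>I. 0 :: real)"
  have [measurable]: "o0 \<in> space L" by (simp add: o0_def space_L)
  have trans: "(\<integral>\<^sup>+x. f (P s x r) \<partial>L) = (\<integral>\<^sup>+x. f x \<partial>L)" if "f \<in> borel_measurable L" for f s r
    using nn_integral_PiM_lborel_translation[OF fin, of f "\<lambda>i. s * r i"] that
    by (simp add: L_def P_def)
  have add': "T (P 1 x y) = P 1 (T x) (T y)" if "x \<in> I \<rightarrow>\<^sub>E UNIV" "y \<in> I \<rightarrow>\<^sub>E UNIV" for x y
    using add[OF that] by (simp add: P_def)
  have sf: "sigma_finite_measure L"
    unfolding L_def by (rule sigma_finite_PiM_lborel[OF fin])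
  then interpret LL: pair_sigma_finite L L
    by (simp add: pair_sigma_finite_def)
  have QL: "(\<integral>\<^sup>+x. indicator Q x \<partial>L) = 1"
    unfolding L_def Q_def using fin
    by (subst nn_integral_indicator)
       (auto simp: product_sigma_finite.emeasure_PiM product_sigma_finite_def
          lborel.sigma_finite_measure_axioms intro!: sets_PiM_I_finite)

  \<comment> \<open>The scaling factor of \<open>T\<close>: the measure of the set of points
    \<open>x\<close> for which \<open>- T x\<close> lies in the unit cube.\<close>
  define \<kappa> where "\<kappa> = (\<integral>\<^sup>+x. indicator Q (P (-1) o0 (T x)) \<partial>L)"
  txt \<open>Tonelli for the double integral of \<open>1\<^sub>E (T x) 1\<^sub>Q (y - T x)\<close> over \<open>x\<close> and \<open>y\<close>.\<close>
  have unique: "(\<integral>\<^sup>+x. indicator E (T x) \<partial>L) = \<kappa> * emeasure L E" if [measurable]: "E \<in> sets L" for E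
  proof -
    have "(\<integral>\<^sup>+x. indicator E (T x) \<partial>L)
        = (\<integral>\<^sup>+x. \<integral>\<^sup>+y. indicator E (T x) * indicator Q (P (-1) y (T x)) \<partial>L \<partial>L)"
    proof (rule nn_integral_cong)
      fix x assume [measurable]: "x \<in> space L"
      have "(\<integral>\<^sup>+y. indicator E (T x) * indicator Q (P (-1) y (T x)) \<partial>L)
          = indicator E (T x) * (\<integral>\<^sup>+y. indicator Q (P (-1) y (T x)) \<partial>L)"
        by (rule nn_integral_cmult) measurable
      also have "(\<integral>\<^sup>+y. indicator Q (P (-1) y (T x)) \<partial>L) = 1"
        by (subst trans) (simp_all add: QL del: nn_integral_indicator)
      finally show "indicator E (T x)
          = (\<integral>\<^sup>+y. indicator E (T x) * indicator Q (P (-1) y (T x)) \<partial>L)" by (simp only: mult_1_right)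
    qed
    also have "\<dots> = (\<integral>\<^sup>+y. \<integral>\<^sup>+x. indicator E (T x) * indicator Q (P (-1) y (T x)) \<partial>L \<partial>L)"
      by (rule LL.Fubini') measurable
    also have "\<dots> = (\<integral>\<^sup>+y. \<integral>\<^sup>+x. indicator E (P 1 (T x) y) * indicator Q (P (-1) o0 (T x)) \<partial>L \<partial>L)"
    proof (rule nn_integral_cong)
      fix y assume y: "y \<in> space L"
      \<comment> \<open>Translating \<open>x\<close> by a preimage \<open>u\<close> of
        \<open>y\<close> turns \<open>T x\<close> into \<open>T x + y\<close>. The cube factor then
        reads \<open>- T x\<close> and no longer depends on \<open>y\<close>, so that the integral
        over \<open>y\<close> gives the measure of \<open>E\<close>.\<close>
      then obtain u where u: "u \<in> I \<rightarrow>\<^sub>E UNIV" "T u = y"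
        using surj by (auto simp: space_L)
      have [measurable]: "y \<in> space L" by (fact y)
      have "(\<integral>\<^sup>+x. indicator E (T x) * indicator Q (P (-1) y (T x)) \<partial>L)
          = (\<integral>\<^sup>+x. indicator E (T (P 1 x u)) *
               indicator Q (P (-1) y (T (P 1 x u))) \<partial>L)"
        by (rule trans[symmetric]) measurable
      also have "\<dots> = (\<integral>\<^sup>+x. indicator E (P 1 (T x) y) * indicator Q (P (-1) o0 (T x)) \<partial>L)"
        by (intro nn_integral_cong) (simp add: add' u space_L, simp add: P_def o0_def cong: restrict_cong)
      finally show "(\<integral>\<^sup>+x. indicator E (T x) * indicator Q (P (-1) y (T x)) \<partial>L) = \<dots>" .
    qed
    also have "\<dots> = (\<integral>\<^sup>+x. \<integral>\<^sup>+y. indicator E (P 1 (T x) y) * indicator Q (P (-1) o0 (T x)) \<partial>L \<partial>L)"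
      by (rule LL.Fubini') measurable
    also have "\<dots> = (\<integral>\<^sup>+x. indicator Q (P (-1) o0 (T x)) * emeasure L E \<partial>L)"
    proof (rule nn_integral_cong)
      fix x assume x: "x \<in> space L"
      have [measurable]: "T x \<in> space L" using T_in x by (simp add: space_L)
      have "(\<integral>\<^sup>+y. indicator E (P 1 (T x) y) * indicator Q (P (-1) o0 (T x)) \<partial>L)
          = (\<integral>\<^sup>+y. indicator E (P 1 y (T x)) \<partial>L) * indicator Q (P (-1) o0 (T x))"
        unfolding P_commute[of _ "T x"] by (rule nn_integral_multc) measurable
      also have "(\<integral>\<^sup>+y. indicator E (P 1 y (T x)) \<partial>L) = emeasure L E"
        by (subst trans) auto
      finally show "(\<integral>\<^sup>+y. indicator E (P 1 (T x) y) * indicator Q (P (-1) o0 (T x)) \<partial>L)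
        = indicator Q (P (-1) o0 (T x)) * emeasure L E" by (simp add: mult.commute)
    qed
    also have "\<dots> = \<kappa> * emeasure L E"
      unfolding \<kappa>_def by (rule nn_integral_multc) measurable
    finally show ?thesis .
  qed

  define Z :: "('i \<Rightarrow> real) set" where "Z = I \<rightarrow>\<^sub>E \<int>"
  have ZX: "z \<in> I \<rightarrow>\<^sub>E UNIV" if "z \<in> Z" for z
    using that by (auto simp: Z_def)
  have "countable Z"
    unfolding Z_def using fin by (intro countable_PiE) (auto simp: Ints_def)
  have fund: "(\<integral>\<^sup>+z. indicator Q (P s x z) \<partial>count_space Z) = 1"
    if "s = 1 \<or> s = -1" for x s
    using nn_integral_integer_translates[OF fin that] unfolding Q_def Z_def P_def .
  txt \<open>Sum \<open>1\<^sub>Q (T x) 1\<^sub>Q (x - z)\<close> over the lattice points \<open>z\<close> and translate \<open>x\<close> by \<open>z\<close>.\<close>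
  have "(\<integral>\<^sup>+x. indicator Q (T x) \<partial>L)
      = (\<integral>\<^sup>+x. \<integral>\<^sup>+z. indicator Q (T x) * indicator Q (P (-1) x z) \<partial>count_space Z \<partial>L)"
    by (intro nn_integral_cong) (simp add: nn_integral_cmult fund)
  also have "\<dots> = (\<integral>\<^sup>+z. \<integral>\<^sup>+x. indicator Q (T x) * indicator Q (P (-1) x z) \<partial>L \<partial>count_space Z)"
  proof (rule nn_integral_count_space_nn_integral)
    fix z assume "z \<in> Z"
    then have [measurable]: "z \<in> space L" using ZX by (simp add: space_L)
    show "(\<lambda>x. indicator Q (T x) * indicator Q (P (-1) x z) :: ennreal) \<in> borel_measurable L"
      by measurable
  qed fact
  also have "\<dots> = (\<integral>\<^sup>+z. \<integral>\<^sup>+x. indicator Q (P 1 (T x) (T z)) * indicator Q x \<partial>L \<partial>count_space Z)"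
  proof (rule nn_integral_cong)
    fix z assume "z \<in> space (count_space Z)"
    then have z: "z \<in> I \<rightarrow>\<^sub>E UNIV" using ZX by simp
    then have [measurable]: "z \<in> space L" by (simp add: space_L)
    have "(\<integral>\<^sup>+x. indicator Q (T x) * indicator Q (P (-1) x z) \<partial>L)
        = (\<integral>\<^sup>+x. indicator Q (T (P 1 x z))
             * indicator Q (P (-1) (P 1 x z) z) \<partial>L)"
      by (rule trans[symmetric]) measurable
    also have "\<dots> = (\<integral>\<^sup>+x. indicator Q (P 1 (T x) (T z)) * indicator Q x \<partial>L)"
      by (intro nn_integral_cong) (simp add: add' z space_L, simp add: P_def PiE_restrict cong: restrict_cong)
    finally show "(\<integral>\<^sup>+x. indicator Q (T x) * indicator Q (P (-1) x z) \<partial>L) = \<dots>" .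
  qed
  \<comment> \<open>As \<open>z\<close> runs through the lattice, so does \<open>T z\<close>; after
    this replacement the sum over \<open>z\<close> of the first factor is 1 for every
    \<open>x\<close>.\<close>
  also have "\<dots> = (\<integral>\<^sup>+z. \<integral>\<^sup>+x. indicator Q (P 1 (T x) z) * indicator Q x \<partial>L \<partial>count_space Z)"
    using bij unfolding Z_def by (rule nn_integral_bij_count_space)
  also have "\<dots> = (\<integral>\<^sup>+x. \<integral>\<^sup>+z. indicator Q (P 1 (T x) z) * indicator Q x \<partial>count_space Z \<partial>L)"
  proof (rule nn_integral_count_space_nn_integral[symmetric])
    fix z assume "z \<in> Z"
    then have [measurable]: "z \<in> space L" using ZX by (simp add: space_L)
    show "(\<lambda>x. indicator Q (P 1 (T x) z) * indicator Q x :: ennreal) \<in> borel_measurable L"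
      by measurable
  qed fact
  also have "\<dots> = 1"
    using fund[of 1] by (simp add: nn_integral_multc QL del: nn_integral_indicator)
  finally have "\<kappa> * emeasure L Q = 1"
    using unique[OF Q] by simp
  then have "\<kappa> = 1" using QL by simp
  have "emeasure L (T -` D \<inter> space L) = (\<integral>\<^sup>+x. indicator (T -` D \<inter> space L) x \<partial>L)"
    by (rule nn_integral_indicator[symmetric]) measurable
  also have "\<dots> = (\<integral>\<^sup>+x. indicator D (T x) \<partial>L)"
    by (intro nn_integral_cong) (auto simp: indicator_def)
  also have "\<dots> = emeasure L D"
    using unique[OF D] \<open>\<kappa> = 1\<close> by simp
  finally show ?thesis .
qed

section \<open>Lattice volume in coordinates\<close>

lemma net_flow_add: "net_flow E (\<lambda>e. x e + y e) k = net_flow E x k + net_flow E y k"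
  by (simp add: net_flow_def case_prod_unfold distrib_right sum.distrib)

lemma net_flow_diff: "net_flow E (\<lambda>e. x e - y e) k = net_flow E x k - net_flow E y k"
  by (simp add: net_flow_def case_prod_unfold left_diff_distrib sum_subtractf)

lemma net_flow_sum:
  "net_flow E (\<lambda>e. \<Sum>i\<in>I. t i * v i e) k = (\<Sum>i\<in>I. t i * net_flow E (v i) k)"
  unfolding net_flow_def case_prod_unfold
  by (simp add: sum_distrib_left sum_distrib_right mult.assoc sum.swap[of _ E I])

lemma flow_space_zero_iff:
  "x \<in> flow_space E (replicate N 0) \<longleftrightarrow> x \<in> edge_space E \<and> (\<forall>k\<in>{1..N + 1}. net_flow E x k = 0)"
proof -
  have "(replicate N 0 @ [- sum_list (replicate N 0)]) ! (k - 1) = (0 :: int)" if "k \<in> {1..N + 1}" for k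
    using that by (auto simp: nth_append sum_list_replicate)
  then show ?thesis by (auto simp: flow_space_def)
qed

lemma flow_space_zero_sum:
  assumes "\<And>i. i \<in> I \<Longrightarrow> v i \<in> flow_space E (replicate N 0)"
  shows "(\<lambda>e. \<Sum>i\<in>I. t i * v i e) \<in> flow_space E (replicate N 0)"
  using assms by (simp add: flow_space_zero_iff net_flow_sum edge_space_def)

lemma flow_space_diff:
  assumes "x \<in> flow_space E a" "y \<in> flow_space E a"
  shows "(\<lambda>e. x e - y e) \<in> flow_space E (replicate (length a) 0)"
  using assms unfolding flow_space_zero_iff by (simp add: flow_space_def net_flow_diff edge_space_def)

lemma flow_space_plus_zero:
  assumes "x \<in> flow_space E a" "y \<in> flow_space E (replicate (length a) 0)"
  shows "(\<lambda>e. x e + y e) \<in> flow_space E a"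
  using assms unfolding flow_space_zero_iff by (simp add: flow_space_def net_flow_add edge_space_def)

text \<open>
  The edges \<open>g 0, \<dots>, g (m - 1)\<close> play the role of the complement of a spanning tree, and the
  \<open>w i\<close> are the corresponding fundamental cycles.
\<close>

lemma lattice_volume_eq_coordinates:
  fixes g :: "nat \<Rightarrow> nat \<times> nat"
  assumes m: "m = card E - length a"
    and p0: "p0 \<in> flow_space E a"
    and w: "\<And>i. i < m \<Longrightarrow> w i \<in> flow_lattice E (length a)"
    and w_g: "\<And>i j. i < m \<Longrightarrow> j < m \<Longrightarrow> w i (g j) = of_bool (i = j)"
    and g: "\<And>j. j < m \<Longrightarrow> g j \<in> E"
    and uniq: "\<And>x. x \<in> flow_space E (replicate (length a) 0) \<Longrightarrow>
      (\<And>i. i < m \<Longrightarrow> x (g i) = 0) \<Longrightarrow> x = (\<lambda>e. 0)"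
    and D: "{t \<in> {..<m} \<rightarrow>\<^sub>E UNIV. (\<lambda>e. p0 e + (\<Sum>i<m. t i * w i e)) \<in> S}
      \<in> sets (PiM {..<m} (\<lambda>_. lborel))"
  shows "lattice_volume E a S = measure (PiM {..<m} (\<lambda>_. lborel))
    {t \<in> {..<m} \<rightarrow>\<^sub>E UNIV. (\<lambda>e. p0 e + (\<Sum>i<m. t i * w i e)) \<in> S}"
proof -
  define X :: "(nat \<Rightarrow> real) set" where "X = {..<m} \<rightarrow>\<^sub>E UNIV"
  define L where "L = PiM {..<m} (\<lambda>_. lborel :: real measure)"
  define F where "F = flow_space E (replicate (length a) 0)"
  define \<Lambda> where "\<Lambda> = flow_lattice E (length a)"
  define comb where "comb v t = (\<lambda>e. \<Sum>i<m. t i * v i e)"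
    for v :: "nat \<Rightarrow> nat \<times> nat \<Rightarrow> real" and t :: "nat \<Rightarrow> real"
  note w = w[folded \<Lambda>_def] and uniq = uniq[folded F_def]
  have space_L: "space L = X" by (simp add: L_def X_def space_PiM)
  have \<Lambda>_iff: "x \<in> \<Lambda> \<longleftrightarrow> x \<in> F \<and> (\<forall>e\<in>E. x e \<in> \<int>)" for x
    by (simp add: F_def \<Lambda>_def flow_lattice_def)
  have \<Lambda>F: "x \<in> F" if "x \<in> \<Lambda>" for x
    using that by (simp add: F_def \<Lambda>_def flow_lattice_def)
  have combF: "comb v t \<in> F" if "\<And>i. i < m \<Longrightarrow> v i \<in> F" for v t
    unfolding comb_def F_def by (rule flow_space_zero_sum) (use that F_def in auto)
  have comb_w_g: "comb w t (g j) = t j" if "j < m" for t j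
    using that by (simp add: comb_def w_g of_bool_def if_distrib[of "\<lambda>x. _ * x"] cong: if_cong)
  \<comment> \<open>Both sides are flows with zero net flow that agree on the edges
    \<open>g i\<close>, so \<open>uniq\<close> applies to their difference.\<close>
  have expand: "x = comb w (\<lambda>i. x (g i))" if "x \<in> F" for x
  proof -
    have "(\<lambda>e. x e - comb w (\<lambda>i. x (g i)) e) = (\<lambda>e. 0)"
    proof (rule uniq)
      show "(\<lambda>e. x e - comb w (\<lambda>i. x (g i)) e) \<in> F"
        using flow_space_diff[of x E "replicate (length a) 0" "comb w (\<lambda>i. x (g i))"]
          that combF[of w] \<Lambda>F[OF w] by (simp add: F_def)
    qed (simp add: comb_w_g)
    then show ?thesis by (simp add: fun_eq_iff)
  qed
  have comb_\<Lambda>: "comb v t \<in> \<Lambda>" if v: "\<And>i. i < m \<Longrightarrow> v i \<in> \<Lambda>" and t: "\<And>i. i < m \<Longrightarrow> t i \<in> \<int>" for v t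
    unfolding \<Lambda>_iff
  proof (intro conjI ballI)
    show "comb v t \<in> F" using v \<Lambda>F by (intro combF) blast
    show "comb v t e \<in> \<int>" if "e \<in> E" for e
      unfolding comb_def
    proof (intro Ints_sum Ints_mult)
      fix i assume "i \<in> {..<m}"
      then show "t i \<in> \<int>" "v i e \<in> \<int>" using v t \<Lambda>_iff \<open>e \<in> E\<close> by auto
    qed
  qed
  have g_Ints: "x (g j) \<in> \<int>" if "x \<in> \<Lambda>" "j < m" for x j
    using that g[of j] by (auto simp: \<Lambda>_def flow_lattice_def)
  have basis_iff: "is_flow_lattice_basis E (length a) v \<longleftrightarrow> (\<forall>i<m. v i \<in> \<Lambda>) \<and>
      (\<forall>x\<in>\<Lambda>. \<exists>!c. c \<in> {..<m} \<rightarrow>\<^sub>E UNIV \<and> x = comb v (\<lambda>i. real_of_int (c i)))" for v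
    by (simp add: is_flow_lattice_basis_def m \<Lambda>_def comb_def)

  \<comment> \<open>A lattice point has integer values on the edges \<open>g i\<close>, and these
    are its coefficients in \<open>w\<close>. Thus a lattice basis exists and the choice of
    \<open>v\<close> below is meaningful.\<close>
  have w_basis: "is_flow_lattice_basis E (length a) w"
    unfolding basis_iff
  proof (intro conjI ballI allI impI)
    fix x assume x: "x \<in> \<Lambda>"
    show "\<exists>!c. c \<in> {..<m} \<rightarrow>\<^sub>E UNIV \<and> x = comb w (\<lambda>i. real_of_int (c i))"
    proof (intro ex1I conjI)
      have "comb w (\<lambda>i. real_of_int ((\<lambda>i\<in>{..<m}. \<lfloor>x (g i)\<rfloor>) i)) = comb w (\<lambda>i. x (g i))"
        using g_Ints[OF x] unfolding comb_def by (intro ext sum.cong) (auto simp: Ints_def)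
      then show "x = comb w (\<lambda>i. real_of_int ((\<lambda>i\<in>{..<m}. \<lfloor>x (g i)\<rfloor>) i))"
        using expand[OF \<Lambda>F[OF x]] by simp
      fix c assume c: "c \<in> {..<m} \<rightarrow>\<^sub>E UNIV \<and> x = comb w (\<lambda>i. real_of_int (c i))"
      then have "c i = \<lfloor>x (g i)\<rfloor>" if "i < m" for i
        using comb_w_g[OF that, of "\<lambda>i. real_of_int (c i)"] by simp
      with c show "c = (\<lambda>i\<in>{..<m}. \<lfloor>x (g i)\<rfloor>)"
        by (auto simp: fun_eq_iff PiE_iff extensional_def)
    qed (auto split: if_splits)
  qed (fact w)
  define v where "v = (SOME v. is_flow_lattice_basis E (length a) v)"
  have "is_flow_lattice_basis E (length a) v"
    unfolding v_def by (rule someI[of "is_flow_lattice_basis E (length a)", OF w_basis])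
  then have v: "\<And>i. i < m \<Longrightarrow> v i \<in> \<Lambda>"
    and v_basis: "\<And>x. x \<in> \<Lambda> \<Longrightarrow>
      \<exists>!c. c \<in> {..<m} \<rightarrow>\<^sub>E UNIV \<and> x = comb v (\<lambda>i. real_of_int (c i))"
    by (auto simp: basis_iff)
  define p where "p = (SOME p. p \<in> flow_space E a)"
  have p: "p \<in> flow_space E a"
    unfolding p_def by (rule someI[of "\<lambda>p. p \<in> flow_space E a", OF p0])

  \<comment> \<open>The change of coordinates from the chosen basis \<open>v\<close> to
    \<open>w\<close>: reading off the values on the edges \<open>g j\<close> gives the coefficients
    in \<open>w\<close>.\<close>
  define T where "T t = (\<lambda>j\<in>{..<m}. comb v t (g j))" for t
  have comb_T: "comb w (T t) = comb v t" for t
  proof -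
    have "comb v t = comb w (\<lambda>i. comb v t (g i))"
      by (rule expand) (use combF v \<Lambda>F in auto)
    also have "\<dots> = comb w (T t)"
      by (simp add: comb_def[of w] T_def)
    finally show ?thesis by simp
  qed
  have T_eq: "T t = y" if "comb v t = comb w y" "y \<in> {..<m} \<rightarrow>\<^sub>E A" for t y A
    unfolding T_def that(1) using that(2)
    by (auto simp: comb_w_g fun_eq_iff PiE_iff extensional_def)
  have unimod: "emeasure L (T -` K \<inter> space L) = emeasure L K" if "K \<in> sets L" for K
    unfolding L_def
  proof (rule emeasure_PiM_lborel_unimodular)
    show "T \<in> PiM {..<m} (\<lambda>_. lborel) \<rightarrow>\<^sub>M PiM {..<m} (\<lambda>_. lborel)"
      unfolding T_def comb_def by measurable
    show "T (\<lambda>i\<in>{..<m}. x i + y i) = (\<lambda>i\<in>{..<m}. T x i + T y i)" for x y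
      by (auto simp: T_def comb_def fun_eq_iff ring_distribs sum.distrib)
    show "{..<m} \<rightarrow>\<^sub>E UNIV \<subseteq> T ` ({..<m} \<rightarrow>\<^sub>E UNIV)"
    proof
      fix y :: "nat \<Rightarrow> real" assume y: "y \<in> {..<m} \<rightarrow>\<^sub>E UNIV"
      \<comment> \<open>The vectors \<open>w j\<close> are lattice points, so they are integer
        combinations of \<open>v\<close>, with matrix \<open>B\<close>. Its transpose maps the
        coefficients \<open>y\<close> in \<open>w\<close> to coefficients in \<open>v\<close>, which
        gives the preimage of \<open>y\<close>.\<close>
      have "\<forall>j\<in>{..<m}. \<exists>c. w j = comb v (\<lambda>i. real_of_int (c i))"
        using v_basis[OF w] by blast
      then obtain B where B: "w j = comb v (\<lambda>i. real_of_int (B j i))" if "j < m" for j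
        by (metis lessThan_iff bchoice)
      define t where "t = (\<lambda>i\<in>{..<m}. \<Sum>j<m. y j * real_of_int (B j i))"
      have "comb w y = (\<lambda>e. \<Sum>j<m. y j * comb v (\<lambda>i. real_of_int (B j i)) e)"
        unfolding comb_def[of w] using B by (intro ext sum.cong) auto
      also have "\<dots> = comb v t"
        unfolding comb_def t_def
        by (auto simp: sum_distrib_left sum_distrib_right mult.assoc intro: sum.swap)
      finally have "T t = y" using y by (intro T_eq) auto
      moreover have "t \<in> {..<m} \<rightarrow>\<^sub>E UNIV" by (auto simp: t_def)
      ultimately show "y \<in> T ` ({..<m} \<rightarrow>\<^sub>E UNIV)" by blast
    qed
    show "bij_betw T ({..<m} \<rightarrow>\<^sub>E \<int>) ({..<m} \<rightarrow>\<^sub>E \<int>)"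
    proof (rule bij_betwI')
      fix z z' :: "nat \<Rightarrow> real" assume z: "z \<in> {..<m} \<rightarrow>\<^sub>E \<int>" and z': "z' \<in> {..<m} \<rightarrow>\<^sub>E \<int>"
      \<comment> \<open>Uniqueness in the definition of a basis concerns integer-valued
        coefficients, whereas \<open>z\<close> is a real vector with integer entries; the floor
        passes between the two.\<close>
      define fl where "fl u = (\<lambda>i\<in>{..<m}. \<lfloor>u i\<rfloor>)" for u :: "nat \<Rightarrow> real"
      have fl: "real_of_int (fl u i) = u i" if "u \<in> {..<m} \<rightarrow>\<^sub>E \<int>" "i < m" for u i
        using that by (auto simp: fl_def PiE_iff Ints_def)
      have comb_fl: "comb v (\<lambda>i. real_of_int (fl u i)) = comb v u" if "u \<in> {..<m} \<rightarrow>\<^sub>E \<int>" for u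
        unfolding comb_def by (simp add: fl[OF that])
      have in_X: "fl u \<in> {..<m} \<rightarrow>\<^sub>E UNIV" for u by (auto simp: fl_def)
      show "T z = T z' \<longleftrightarrow> z = z'"
      proof
        assume "T z = T z'"
        then have eq: "comb v z = comb v z'" using comb_T[of z] comb_T[of z'] by simp
        have "comb v z \<in> \<Lambda>" using v z by (intro comb_\<Lambda>) auto
        from v_basis[OF this] have "fl z = fl z'"
          using comb_fl[OF z] comb_fl[OF z'] in_X eq by metis
        then show "z = z'"
          using fl[OF z] fl[OF z'] z z' by (intro PiE_ext[OF z z']) (metis lessThan_iff)
      qed simp
    next
      fix z assume z: "z \<in> {..<m} \<rightarrow>\<^sub>E (\<int> :: real set)"
      then have "comb v z \<in> \<Lambda>" using v by (intro comb_\<Lambda>) auto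
      then show "T z \<in> {..<m} \<rightarrow>\<^sub>E \<int>" by (auto simp: T_def g_Ints)
    next
      fix y assume y: "y \<in> {..<m} \<rightarrow>\<^sub>E (\<int> :: real set)"
      then have "comb w y \<in> \<Lambda>" using w by (intro comb_\<Lambda>) auto
      then obtain c where "comb w y = comb v (\<lambda>i. real_of_int (c i))"
        using v_basis by blast
      also have "\<dots> = comb v (\<lambda>i\<in>{..<m}. real_of_int (c i))"
        by (simp add: comb_def)
      finally have "T (\<lambda>i\<in>{..<m}. real_of_int (c i)) = y"
        using y by (intro T_eq) auto
      then show "\<exists>z\<in>{..<m} \<rightarrow>\<^sub>E \<int>. y = T z"
        by (intro bexI[of _ "\<lambda>i\<in>{..<m}. real_of_int (c i)"]) auto
    qed
  qed (use that L_def in simp_all)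

  define K where "K = {t \<in> X. (\<lambda>e. p0 e + comb w t e) \<in> S}"
  have K: "K \<in> sets L"
    using D by (simp add: K_def X_def L_def comb_def)
  \<comment> \<open>The coefficients in \<open>w\<close> of the difference between the chosen origin
    \<open>p\<close> and the given origin \<open>p0\<close>.\<close>
  define r where "r i = p (g i) - p0 (g i)" for i
  define sh where "sh t = (\<lambda>i\<in>{..<m}. t i + r i)" for t
  have sh: "sh \<in> L \<rightarrow>\<^sub>M L" unfolding sh_def L_def by measurable
  have p_sh: "p e + comb w t e = p0 e + comb w (sh t) e" for t e
  proof -
    have "(\<lambda>e. p e - p0 e) = comb w r"
      using expand[of "\<lambda>e. p e - p0 e"] flow_space_diff[OF p p0] by (simp add: F_def r_def[abs_def])
    from fun_cong[OF this, of e] have "p e = p0 e + comb w r e" by simp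
    moreover have "comb w (sh t) e = comb w t e + comb w r e"
      by (simp add: comb_def sh_def ring_distribs sum.distrib)
    ultimately show ?thesis by simp
  qed
  have TX: "T t \<in> X" for t by (auto simp: T_def X_def)
  have shX: "sh t \<in> X" for t by (auto simp: sh_def X_def)
  \<comment> \<open>Changing the basis and then the origin is \<open>T\<close> followed by the
    translation \<open>sh\<close>, and both preserve the measure.\<close>
  have eq: "{t \<in> X. (\<lambda>e. p e + comb v t e) \<in> S} = T -` (sh -` K \<inter> space L) \<inter> space L"
    by (auto simp: space_L K_def TX shX p_sh[symmetric] comb_T)
  have "emeasure L {t \<in> X. (\<lambda>e. p e + comb v t e) \<in> S} = emeasure L (sh -` K \<inter> space L)"
    unfolding eq by (rule unimod) (rule measurable_sets[OF sh K])
  also have "\<dots> = emeasure (distr L L sh) K"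
    by (rule emeasure_distr[OF sh K, symmetric])
  also have "distr L L sh = L"
    using distr_PiM_lborel_translation[of "{..<m}" r] by (simp add: L_def sh_def[abs_def])
  finally show ?thesis
    by (simp add: lattice_volume_def Let_def measure_def L_def K_def X_def comb_def m
        flip: v_def p_def)
qed

section \<open>The volume recursion\<close>

text \<open>
  The flow polytope of the caracol graph in the coordinates \<open>t (2 j)\<close>, the flow on the edge
  \<open>(n - j, n - j + 1)\<close>, and \<open>t (2 j + 1)\<close>, the flow on \<open>(1, n - j)\<close>, for \<open>j < m = n - 1\<close>.
\<close>

definition caracol_region :: "real \<Rightarrow> nat \<Rightarrow> real \<Rightarrow> real \<Rightarrow> (nat \<Rightarrow> real) set" where
  "caracol_region c m s q = {t \<in> {..<2 * m} \<rightarrow>\<^sub>E UNIV. (\<Sum>j<m. t (2 * j + 1)) \<le> s \<and>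
     (\<forall>j<m. 0 \<le> t (2 * j) \<and> 0 \<le> t (2 * j + 1) \<and>
       t (2 * j) \<le> (if j + 1 = m then q else t (2 * j + 2) + c) + t (2 * j + 1))}"

text \<open>The top pair of coordinates belongs to vertex 2, the first vertex in the sweep. Fixing
  its flow \<open>x\<close> from the source and its flow \<open>p\<close> to the next vertex leaves
  \<open>s - x\<close> at the source and makes the next vertex receive \<open>p + c\<close> from
  elsewhere: \<open>p\<close> along the path and \<open>c\<close> as its own net flow.\<close>

lemma caracol_region_Suc:
  assumes "t \<in> {..<2 * m} \<rightarrow>\<^sub>E UNIV"
  shows "t(2 * m := p, 2 * m + 1 := x) \<in> caracol_region c (Suc m) s q \<longleftrightarrow>
    0 \<le> x \<and> x \<le> s \<and> 0 \<le> p \<and> p \<le> q + x \<and> t \<in> caracol_region c m (s - x) (p + c)"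
proof -
  let ?t = "t(2 * m := p, 2 * m + 1 := x)"
  have t: "?t (2 * j) = t (2 * j)" "?t (2 * j + 1) = t (2 * j + 1)" if "j < m" for j
    using that by auto
  have t2: "?t (2 * j + 2) = (if j + 1 = m then p else t (2 * j + 2))" if "j < m" for j
    using that by auto
  have ext: "?t \<in> {..<2 * Suc m} \<rightarrow>\<^sub>E UNIV"
    using assms by (auto simp: PiE_iff extensional_def)
  have sum: "(\<Sum>j<Suc m. ?t (2 * j + 1)) = (\<Sum>j<m. t (2 * j + 1)) + x"
    using t by (simp del: fun_upd_apply) simp
  \<comment> \<open>The later flows out of vertex 1 are nonnegative and sum to at most
    \<open>s - x\<close>. This gives the outer integral its range from 0 to
    \<open>s\<close>.\<close>
  have le: "x \<le> s" if "t \<in> caracol_region c m (s - x) (p + c)"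
  proof -
    have "0 \<le> (\<Sum>j<m. t (2 * j + 1))"
      using that by (intro sum_nonneg) (auto simp: caracol_region_def)
    then show ?thesis using that by (auto simp: caracol_region_def)
  qed
  have below: "(0 \<le> ?t (2 * j) \<and> 0 \<le> ?t (2 * j + 1) \<and>
      ?t (2 * j) \<le> (if j + 1 = Suc m then q else ?t (2 * j + 2) + c) + ?t (2 * j + 1)) \<longleftrightarrow>
      (0 \<le> t (2 * j) \<and> 0 \<le> t (2 * j + 1) \<and>
      t (2 * j) \<le> (if j + 1 = m then p + c else t (2 * j + 2) + c) + t (2 * j + 1))" if "j < m" for j
    unfolding t[OF that] t2[OF that] using that by auto
  have top: "?t (2 * m) = p" "?t (2 * m + 1) = x" by auto
  have "?t \<in> caracol_region c (Suc m) s q \<longleftrightarrow>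
    0 \<le> x \<and> 0 \<le> p \<and> p \<le> q + x \<and> t \<in> caracol_region c m (s - x) (p + c)"
    unfolding caracol_region_def mem_Collect_eq All_less_Suc sum top
    using ext assms below by (auto simp del: fun_upd_apply)
  then show ?thesis using le by auto
qed

lemma sets_caracol_region:
  "caracol_region c m s q \<in> sets (PiM {..<2 * m} (\<lambda>_. lborel))"
proof -
  let ?M = "PiM {..<2 * m} (\<lambda>_. lborel :: real measure)"
  have comp: "(\<lambda>t. t i) \<in> borel_measurable ?M" if "i < 2 * m" for i
    using measurable_component_singleton[of i "{..<2 * m}" "\<lambda>_. lborel"] that by simp
  have "{t \<in> space ?M. (\<Sum>j<m. t (2 * j + 1)) \<le> s \<and> (\<forall>j\<in>{..<m}. 0 \<le> t (2 * j) \<and> 0 \<le> t (2 * j + 1) \<and>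
       t (2 * j) \<le> (if j + 1 = m then q else t (2 * j + 2) + c) + t (2 * j + 1))} \<in> sets ?M"
  proof (intro sets.sets_Collect_conj sets.sets_Collect_finite_All)
    show "{t \<in> space ?M. (\<Sum>j<m. t (2 * j + 1)) \<le> s} \<in> sets ?M"
      by (intro borel_measurable_le borel_measurable_sum comp borel_measurable_const) auto
    fix j assume "j \<in> {..<m}"
    then have [measurable]: "(\<lambda>t. t (2 * j)) \<in> borel_measurable ?M"
      "(\<lambda>t. t (2 * j + 1)) \<in> borel_measurable ?M"
      by (auto intro!: comp)
    show "{t \<in> space ?M. 0 \<le> t (2 * j)} \<in> sets ?M" "{t \<in> space ?M. 0 \<le> t (2 * j + 1)} \<in> sets ?M"
      by measurable
    show "{t \<in> space ?M. t (2 * j) \<le> (if j + 1 = m then q else t (2 * j + 2) + c) + t (2 * j + 1)}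
      \<in> sets ?M"
    \<comment> \<open>For the last \<open>j\<close> the index \<open>2 * j + 2\<close> equals
      \<open>2 * m\<close> and lies outside the index set of the product; there the bound uses the
      constant \<open>q\<close> instead.\<close>
    proof (cases "j + 1 = m")
      case False
      then have [measurable]: "(\<lambda>t. t (2 * j + 2)) \<in> borel_measurable ?M"
        using \<open>j \<in> {..<m}\<close> by (intro comp) auto
      show ?thesis unfolding if_not_P[OF False] by measurable
    next
      case True
      show ?thesis unfolding if_P[OF True] by measurable
    qed
  qed simp
  then show ?thesis
    by (simp only: caracol_region_def space_PiM space_lborel space_borel Ball_def lessThan_iff)
qed

text \<open>The function \<open>V\<close> of the recursion. The integer exponent covers
  \<open>m = 0\<close>, where the last factor is the inverse of \<open>s + q\<close> and cancels the
  factor before it, leaving 1 if \<open>s + q\<close> is nonzero.\<close>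

definition caracol_region_volume :: "real \<Rightarrow> nat \<Rightarrow> real \<Rightarrow> real \<Rightarrow> real" where
  "caracol_region_volume c m s q =
     s ^ m * (s + (real m + 1) * q) * (s + q + real m * c) powi (int m - 1) / (fact m * fact (m + 1))"

lemma caracol_region_volume_nonneg:
  "0 \<le> s \<Longrightarrow> 0 \<le> q \<Longrightarrow> 0 \<le> c \<Longrightarrow> 0 \<le> caracol_region_volume c m s q"
  unfolding caracol_region_volume_def
  by (intro divide_nonneg_nonneg mult_nonneg_nonneg zero_le_power zero_le_power_int add_nonneg_nonneg)
     simp_all

text \<open>With \<open>z = s + p + (m + 1) c\<close>, the derivative of \<open>p z^m\<close> in
  \<open>p\<close> is \<open>(z + m p) z^(m-1)\<close>, and
  \<open>z + m p = s + (m + 1) (p + c)\<close> is the linear factor of the volume. For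
  \<open>m = 0\<close> positivity of \<open>c\<close> keeps \<open>z\<close> away from 0.\<close>

lemma caracol_region_volume_antideriv:
  assumes "0 \<le> s" "0 < c" "0 \<le> p"
  shows "((\<lambda>p. s ^ m * p * (s + p + (real m + 1) * c) ^ m / (fact m * fact (m + 1)))
    has_real_derivative caracol_region_volume c m s (p + c)) (at p)"
proof (cases m)
  case 0
  with assms show ?thesis
    by (auto intro!: derivative_eq_intros simp: caracol_region_volume_def power_int_minus field_simps)
next
  case (Suc k)
  let ?z = "s + p + (real m + 1) * c"
  have "((\<lambda>p. s + p + (real m + 1) * c) has_real_derivative 1) (at p)"
    by (auto intro!: derivative_eq_intros)
  from DERIV_power[OF this, of m]
  have "((\<lambda>p. (s + p + (real m + 1) * c) ^ m) has_real_derivative real m * ?z ^ k) (at p)"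
    using Suc by simp
  from DERIV_mult'[OF DERIV_cmult_Id this, of "s ^ m"]
  have "((\<lambda>p. s ^ m * p * (s + p + (real m + 1) * c) ^ m / (fact m * fact (m + 1)))
    has_real_derivative (s ^ m * p * (real m * ?z ^ k) + s ^ m * ?z ^ m) / (fact m * fact (m + 1))) (at p)"
    by (intro DERIV_cdivide)
  also have "s ^ m * p * (real m * ?z ^ k) + s ^ m * ?z ^ m = s ^ m * (s + (real m + 1) * (p + c)) * ?z ^ k"
    unfolding Suc power_Suc[of ?z] by (simp add: algebra_simps)
  also have "\<dots> / (fact m * fact (m + 1)) = caracol_region_volume c m s (p + c)"
  proof -
    have "caracol_region_volume c m s (p + c) = s ^ m * (s + (real m + 1) * (p + c)) *
        (s + (p + c) + real m * c) ^ k / (fact m * fact (m + 1))"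
      using Suc by (simp add: caracol_region_volume_def)
    also have "s + (p + c) + real m * c = ?z" by (simp add: algebra_simps)
    finally show ?thesis by simp
  qed
  finally show ?thesis .
qed

text \<open>Induction on the number of vertices left: Tonelli separates the two top coordinates,
  \<open>p\<close> is integrated first and then \<open>x\<close>. Strict positivity of
  \<open>q\<close> makes \<open>s + q\<close> nonzero in the base case, and it passes to
  \<open>p + c\<close> in the induction.\<close>

lemma emeasure_caracol_region:
  assumes "0 < c" "0 \<le> s" "0 < q"
  shows "emeasure (PiM {..<2 * m} (\<lambda>_. lborel)) (caracol_region c m s q)
    = ennreal (caracol_region_volume c m s q)"
  using assms(2,3)
proof (induction m arbitrary: s q)
  case 0
  have "caracol_region c 0 s q = {\<lambda>_. undefined}"
    using 0 by (auto simp: caracol_region_def)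
  then show ?case
    using 0 by (simp add: PiM_empty caracol_region_volume_def power_int_minus)
next
  case (Suc m)
  interpret product_sigma_finite "\<lambda>_ :: nat. lborel :: real measure"
    by (simp add: product_sigma_finite_def lborel.sigma_finite_measure_axioms)
  let ?M = "\<lambda>I. PiM I (\<lambda>_. lborel :: real measure)"
  let ?R = "caracol_region c (Suc m) s q"
  let ?fm = "fact m * fact (m + 1) :: real"
  let ?w = "s + q + (real m + 1) * c"
  have idx: "{..<2 * Suc m} = insert (2 * m + 1) (insert (2 * m) {..<2 * m})"
    by auto
  have R: "?R \<in> sets (?M (insert (2 * m + 1) (insert (2 * m) {..<2 * m})))"
    using sets_caracol_region[of c "Suc m"] unfolding idx .
  have upd: "(\<lambda>t. indicator ?R (t(2 * m + 1 := x)) :: ennreal) \<in> borel_measurable (?M (insert (2 * m) {..<2 * m}))" for x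
    using R by (intro measurable_compose[OF measurable_fun_upd[where J = "insert (2 * m) {..<2 * m}"] borel_measurable_indicator[OF R]]) auto
  have 1: "(\<integral>\<^sup>+t. indicator ?R (t(2 * m := p, 2 * m + 1 := x)) \<partial>?M {..<2 * m})
      = ennreal (caracol_region_volume c m (s - x) (p + c)) * indicator {0..q + x} p * indicator {0..s} x" for x p
  proof -
    have "(\<integral>\<^sup>+t. indicator ?R (t(2 * m := p, 2 * m + 1 := x)) \<partial>?M {..<2 * m})
      = (\<integral>\<^sup>+t. indicator (caracol_region c m (s - x) (p + c)) t * (indicator {0..q + x} p * indicator {0..s} x) \<partial>?M {..<2 * m})"
    proof (rule nn_integral_cong)
      fix t assume "t \<in> space (?M {..<2 * m})"
      then have "t \<in> {..<2 * m} \<rightarrow>\<^sub>E UNIV" by (simp add: space_PiM)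
      note eq = caracol_region_Suc[OF this, of p x c s q]
      show "indicator ?R (t(2 * m := p, 2 * m + 1 := x))
        = indicator (caracol_region c m (s - x) (p + c)) t * (indicator {0..q + x} p * indicator {0..s} x :: ennreal)"
        unfolding indicator_def atLeastAtMost_iff of_bool_conj[symmetric] eq
        by (rule arg_cong[of _ _ of_bool]) blast
    qed
    also have "\<dots> = emeasure (?M {..<2 * m}) (caracol_region c m (s - x) (p + c)) * (indicator {0..q + x} p * indicator {0..s} x)"
      using sets_caracol_region[of c m "s - x" "p + c"] by (subst nn_integral_multc) auto
    \<comment> \<open>Where both indicators are 1, \<open>s - x\<close> is nonnegative and
      \<open>p + c\<close> is positive, so the induction hypothesis applies; elsewhere both sides
      are 0.\<close>
    finally show ?thesis
      using Suc.IH[of "s - x" "p + c"] assms(1) by (auto simp: indicator_def)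
  qed
  \<comment> \<open>The antiderivative vanishes at \<open>p = 0\<close>. At \<open>p = q + x\<close>
    its power has the base \<open>s - x + q + x + (m + 1) c\<close>, from which \<open>x\<close>
    cancels, so \<open>?w ^ m\<close> is a constant for the outer integral.\<close>
  have 2: "(\<integral>\<^sup>+p. ennreal (caracol_region_volume c m (s - x) (p + c)) * indicator {0..q + x} p * indicator {0..s} x \<partial>lborel)
      = ennreal ((s - x) ^ m * (q + x) * ?w ^ m / ?fm) * indicator {0..s} x" for x
  proof (cases "x \<in> {0..s}")
    case True
    have [measurable]: "(\<lambda>p. (s - x + (p + c) + real m * c) powi (int m - 1)) \<in> borel_measurable borel"
      by (cases m) (simp_all add: power_int_minus)
    have "(\<lambda>p. caracol_region_volume c m (s - x) (p + c)) \<in> borel_measurable borel"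
      unfolding caracol_region_volume_def by (rule borel_measurable_divide) measurable
    then have "(\<integral>\<^sup>+p. ennreal (caracol_region_volume c m (s - x) (p + c)) * indicator {0..q + x} p \<partial>lborel)
      = ennreal ((s - x) ^ m * (q + x) * (s - x + (q + x) + (real m + 1) * c) ^ m / ?fm
        - (s - x) ^ m * 0 * (s - x + 0 + (real m + 1) * c) ^ m / ?fm)"
      using True Suc.prems assms(1)
      by (intro nn_integral_FTC_Icc caracol_region_volume_antideriv caracol_region_volume_nonneg) auto
    then show ?thesis using True by simp
  qed simp
  have "emeasure (?M {..<2 * Suc m}) ?R
      = (\<integral>\<^sup>+t. indicator ?R t \<partial>?M (insert (2 * m + 1) (insert (2 * m) {..<2 * m})))"
    using R by (simp only: idx nn_integral_indicator)
  also have "\<dots> = (\<integral>\<^sup>+x. \<integral>\<^sup>+t. indicator ?R (t(2 * m + 1 := x)) \<partial>?M (insert (2 * m) {..<2 * m}) \<partial>lborel)"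
    by (rule product_nn_integral_insert_rev[OF _ _ borel_measurable_indicator[OF R]]) auto
  also have "\<dots> = (\<integral>\<^sup>+x. \<integral>\<^sup>+p. \<integral>\<^sup>+t. indicator ?R (t(2 * m := p, 2 * m + 1 := x)) \<partial>?M {..<2 * m} \<partial>lborel \<partial>lborel)"
    by (rule nn_integral_cong, rule product_nn_integral_insert_rev[OF _ _ upd]) simp_all
  also have "\<dots> = (\<integral>\<^sup>+x. ennreal ((s - x) ^ m * (q + x) * ?w ^ m / ?fm) * indicator {0..s} x \<partial>lborel)"
    unfolding 1 2 ..
  also have "\<dots> = ennreal (caracol_region_volume c (Suc m) s q)"
  proof -
    \<comment> \<open>Integration by parts: the derivative of \<open>A\<close> is
      \<open>- (s - x)^m\<close> and that of \<open>B\<close> is \<open>- A\<close>, so the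
      \<open>A\<close> terms cancel in the derivative of \<open>K\<close>. Both \<open>A\<close> and
      \<open>B\<close> vanish at \<open>x = s\<close>.\<close>
    define A where "A x = (s - x) ^ (m + 1) / (real m + 1)" for x
    define B where "B x = (s - x) ^ (m + 2) / ((real m + 1) * (real m + 2))" for x
    define K where "K x = - (A x * (q + x) + B x) * (?w ^ m / ?fm)" for x
    have K: "(K has_real_derivative (s - x) ^ m * (q + x) * ?w ^ m / ?fm) (at x)" for x
    proof -
      have pow: "((\<lambda>x. (s - x) ^ k) has_real_derivative - (real k * (s - x) ^ (k - 1))) (at x)" for k
        using DERIV_power[of "\<lambda>x. s - x" "-1" x UNIV k] by (auto intro!: derivative_eq_intros)
      have nz: "real m + 1 \<noteq> 0" "real m + 2 \<noteq> 0" by linarith+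
      have "- (real (m + 1) * (s - x) ^ (m + 1 - 1)) / (real m + 1) = - ((s - x) ^ m)"
        using nz by (simp add: divide_simps)
      then have A: "(A has_real_derivative - ((s - x) ^ m)) (at x)"
        using DERIV_cdivide[OF pow[of "m + 1"], of "real m + 1"] by (simp only: A_def[abs_def])
      have "- (real (m + 2) * (s - x) ^ (m + 2 - 1)) / ((real m + 1) * (real m + 2)) = - A x"
        unfolding A_def using nz by (simp add: divide_simps)
      then have B: "(B has_real_derivative - A x) (at x)"
        using DERIV_cdivide[OF pow[of "m + 2"], of "(real m + 1) * (real m + 2)"]
        by (simp only: B_def[abs_def])
      have "((\<lambda>x. q + x) has_real_derivative 1) (at x)"
        by (auto intro!: derivative_eq_intros)
      from DERIV_cmult_right[OF DERIV_minus[OF DERIV_add[OF DERIV_mult'[OF A this] B]], of "?w ^ m / ?fm"]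
      show ?thesis by (simp add: K_def[abs_def])
    qed
    have "(\<integral>\<^sup>+x. ennreal ((s - x) ^ m * (q + x) * ?w ^ m / ?fm) * indicator {0..s} x \<partial>lborel)
        = ennreal (K s - K 0)"
      using Suc.prems assms(1) by (intro nn_integral_FTC_Icc K) auto
    also have "K s - K 0 = caracol_region_volume c (Suc m) s q"
    proof -
      have nz: "real m + 1 \<noteq> 0" "real m + 2 \<noteq> 0" by linarith+
      have "A s = 0" "B s = 0" by (simp_all add: A_def B_def)
      then have "K s - K 0 = (A 0 * q + B 0) * (?w ^ m / ?fm)"
        unfolding K_def by (simp only: mult_zero_left add_0_left minus_zero diff_0 add_0_right mult_minus_left minus_minus)
      also have "A 0 * q + B 0 = s ^ Suc m * (s + (real m + 2) * q) / ((real m + 1) * (real m + 2))"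
        using nz unfolding A_def B_def by (simp add: divide_simps) (simp add: algebra_simps)
      also have "\<dots> * (?w ^ m / ?fm)
          = s ^ Suc m * (s + (real m + 2) * q) * ?w ^ m / ((real m + 1) * (real m + 2) * ?fm)"
        by simp
      also have "(real m + 1) * (real m + 2) * ?fm = fact (Suc m) * fact (Suc m + 1)"
        by (simp add: algebra_simps)
      finally show ?thesis by (simp add: caracol_region_volume_def add.commute)
    qed
    finally show ?thesis .
  qed
  finally show ?case .
qed

section \<open>Flows on the caracol graph\<close>

text \<open>The path edges \<open>(1, 2)\<close> and \<open>(n + 1, n + 2)\<close> are counted with
  the source edges and the sink edges. The three classes become disjoint and are indexed without
  exceptions.\<close>

lemma caracol_eq:
  assumes "n \<ge> 1"
  shows "caracol n = {1} \<times> {2..n + 1} \<union> (\<lambda>i. (i, i + 1)) ` {2..n} \<union> {2..n + 1} \<times> {n + 2}"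
proof (intro set_eqI)
  fix e :: "nat \<times> nat"
  obtain i j where e: "e = (i, j)" by (cases e)
  show "e \<in> caracol n \<longleftrightarrow> e \<in> {1} \<times> {2..n + 1} \<union> (\<lambda>i. (i, i + 1)) ` {2..n} \<union> {2..n + 1} \<times> {n + 2}"
    using assms unfolding e caracol_def by (auto simp: image_iff)
qed

lemma sum_caracol:
  assumes "n \<ge> 1"
  shows "(\<Sum>e\<in>caracol n. f e)
    = (\<Sum>i=2..n + 1. f (1, i)) + (\<Sum>i=2..n. f (i, i + 1)) + (\<Sum>i=2..n + 1. f (i, n + 2))"
proof -
  have "(\<Sum>e\<in>caracol n. f e) = (\<Sum>e\<in>{1} \<times> {2..n + 1}. f e) + (\<Sum>e\<in>(\<lambda>i. (i, i + 1)) ` {2..n}. f e)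
      + (\<Sum>e\<in>{2..n + 1} \<times> {n + 2}. f e)"
    unfolding caracol_eq[OF assms]
    by (subst sum.union_disjoint; (subst sum.union_disjoint)?) auto
  also have "(\<Sum>e\<in>{1} \<times> {2..n + 1}. f e) = (\<Sum>i=2..n + 1. f (1, i))"
    by (subst sum.cartesian_product') simp
  also have "(\<Sum>e\<in>{2..n + 1} \<times> {n + 2}. f e) = (\<Sum>i=2..n + 1. f (i, n + 2))"
    by (subst sum.cartesian_product') simp
  also have "(\<Sum>e\<in>(\<lambda>i. (i, i + 1)) ` {2..n}. f e) = (\<Sum>i=2..n. f (i, i + 1))"
    by (subst sum.reindex) (auto simp: inj_on_def)
  finally show ?thesis .
qed

lemma card_caracol: "n \<ge> 1 \<Longrightarrow> card (caracol n) = 3 * n - 1"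
  using sum_caracol[of n "\<lambda>_. 1 :: nat"] by simp

text \<open>The conditions \<open>k \<le> n\<close> and \<open>3 \<le> k\<close> reflect the
  regrouping of edges: \<open>(n + 1, n + 2)\<close> is already a sink edge and
  \<open>(1, 2)\<close> a source edge.\<close>

lemma net_flow_caracol:
  assumes "n \<ge> 1"
  shows "net_flow (caracol n) x 1 = (\<Sum>i=2..n + 1. x (1, i))"
    and "2 \<le> k \<Longrightarrow> k \<le> n + 1 \<Longrightarrow> net_flow (caracol n) x k =
      x (k, n + 2) + (if k \<le> n then x (k, k + 1) else 0) - x (1, k) - (if 3 \<le> k then x (k - 1, k) else 0)"
    and "net_flow (caracol n) x (n + 2) = - (\<Sum>i=2..n + 1. x (i, n + 2))"
proof -
  have nf: "net_flow (caracol n) x k =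
      (\<Sum>i=2..n + 1. x (1, i) * (of_bool (1 = k) - of_bool (i = k))) +
      (\<Sum>i=2..n. x (i, i + 1) * (of_bool (i = k) - of_bool (i + 1 = k))) +
      (\<Sum>i=2..n + 1. x (i, n + 2) * (of_bool (i = k) - of_bool (n + 2 = k)))" for k
    using sum_caracol[OF assms, of "\<lambda>(i, j). x (i, j) * (of_bool (i = k) - of_bool (j = k))"]
    by (simp add: net_flow_def)
  show "net_flow (caracol n) x 1 = (\<Sum>i=2..n + 1. x (1, i))"
    unfolding nf by simp
  show "net_flow (caracol n) x (n + 2) = - (\<Sum>i=2..n + 1. x (i, n + 2))"
    unfolding nf by (simp add: sum_negf)
  assume k: "2 \<le> k" "k \<le> n + 1"
  have delta: "(\<Sum>i=2..m. y i * of_bool (i = k')) = (if 2 \<le> k' \<and> k' \<le> m then y k' else 0)"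
    for m k' and y :: "nat \<Rightarrow> real"
    by (simp add: of_bool_def if_distrib[of "\<lambda>z. _ * z"] cong: if_cong)
  have Suc_k: "of_bool (i + 1 = k) = (of_bool (i = k - 1) :: real)" for i
    using k by auto
  have 1: "(\<Sum>i=2..n + 1. x (1, i) * (of_bool (1 = k) - of_bool (i = k))) = - x (1, k)"
    using delta[of "\<lambda>i. x (1, i)" k "n + 1"] k by (simp add: sum_negf)
  have 2: "(\<Sum>i=2..n. x (i, i + 1) * (of_bool (i = k) - of_bool (i + 1 = k)))
      = (if k \<le> n then x (k, k + 1) else 0) - (if 3 \<le> k then x (k - 1, k) else 0)"
    unfolding Suc_k right_diff_distrib sum_subtractf delta using k by auto
  have 3: "(\<Sum>i=2..n + 1. x (i, n + 2) * (of_bool (i = k) - of_bool (n + 2 = k))) = x (k, n + 2)"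
    using delta[of "\<lambda>i. x (i, n + 2)" k "n + 1"] k by simp
  show "net_flow (caracol n) x k =
      x (k, n + 2) + (if k \<le> n then x (k, k + 1) else 0) - x (1, k) - (if 3 \<le> k then x (k - 1, k) else 0)"
    unfolding nf 1 2 3 by simp
qed

text \<open>Every edge contributes its flow once with each sign. This yields the net flow at the
  sink from that at all other vertices.\<close>

lemma sum_net_flow_eq_0:
  assumes "finite K" "\<And>i j. (i, j) \<in> E \<Longrightarrow> i \<in> K \<and> j \<in> K"
  shows "(\<Sum>k\<in>K. net_flow E x k) = 0"
proof -
  have "(\<Sum>k\<in>K. net_flow E x k)
      = (\<Sum>e\<in>E. x e * (\<Sum>k\<in>K. of_bool (fst e = k) - of_bool (snd e = k)))"
    unfolding net_flow_def case_prod_unfold sum_distrib_left by (subst sum.swap) simp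
  also have "\<dots> = (\<Sum>e\<in>E. 0)"
  proof (rule sum.cong)
    fix e assume "e \<in> E"
    then have "fst e \<in> K" "snd e \<in> K" using assms(2)[of "fst e" "snd e"] by auto
    then show "x e * (\<Sum>k\<in>K. of_bool (fst e = k) - of_bool (snd e = k)) = 0"
      using assms(1) by (simp add: sum_subtractf of_bool_def)
  qed simp
  finally show ?thesis by simp
qed

text \<open>The flow with net flow \<open>w\<close> and coordinates \<open>t\<close>: conservation
  at vertex 1 determines the edge \<open>(1, n + 1)\<close>, and conservation at \<open>i\<close>
  determines \<open>(i, n + 2)\<close>. Keeping \<open>w\<close> as a parameter yields cycles for
  \<open>w = 0\<close> and an origin for \<open>t = 0\<close>.\<close>

definition caracol_flow :: "nat \<Rightarrow> (nat \<Rightarrow> real) \<Rightarrow> (nat \<Rightarrow> real) \<Rightarrow> nat \<times> nat \<Rightarrow> real" where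
  "caracol_flow n w t = (\<lambda>(i, j).
     let x = (\<lambda>k. if k \<le> n then t (2 * (n - k) + 1) else w 1 - (\<Sum>l<n - 1. t (2 * l + 1)))
     in if i = 1 \<and> 2 \<le> j \<and> j \<le> n + 1 then x j
        else if 2 \<le> i \<and> i \<le> n \<and> j = i + 1 then t (2 * (n - i))
        else if 2 \<le> i \<and> i \<le> n + 1 \<and> j = n + 2
          then w i + (if 3 \<le> i then t (2 * (n + 1 - i)) else 0) + x i
            - (if i \<le> n then t (2 * (n - i)) else 0)
        else 0)"

text \<open>The edge that carries the coordinate \<open>i\<close>. The edges left over,
  \<open>(1, n + 1)\<close> and all \<open>(k, n + 2)\<close> with
  \<open>2 \<le> k \<le> n + 1\<close>, form a spanning tree.\<close>

definition caracol_coordinate :: "nat \<Rightarrow> nat \<Rightarrow> nat \<times> nat" where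
  "caracol_coordinate n i =
     (if odd i then (1, n - i div 2) else (n - i div 2, n - i div 2 + 1))"

lemma caracol_flow_simps:
  "2 \<le> k \<Longrightarrow> k \<le> n \<Longrightarrow> caracol_flow n w t (1, k) = t (2 * (n - k) + 1)"
  "n \<ge> 1 \<Longrightarrow> caracol_flow n w t (1, n + 1) = w 1 - (\<Sum>l<n - 1. t (2 * l + 1))"
  "2 \<le> k \<Longrightarrow> k \<le> n \<Longrightarrow> caracol_flow n w t (k, k + 1) = t (2 * (n - k))"
  "2 \<le> k \<Longrightarrow> k \<le> n + 1 \<Longrightarrow> caracol_flow n w t (k, n + 2) =
     w k + (if 3 \<le> k then t (2 * (n + 1 - k)) else 0) + caracol_flow n w t (1, k)
       - (if k \<le> n then t (2 * (n - k)) else 0)"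
  by (auto simp: caracol_flow_def Let_def)

lemma caracol_coordinate_in:
  "i < 2 * (n - 1) \<Longrightarrow> caracol_coordinate n i \<in> caracol n"
  by (subst caracol_eq) (auto simp: caracol_coordinate_def)

lemma caracol_flow_coordinate:
  assumes "i < 2 * (n - 1)"
  shows "caracol_flow n w t (caracol_coordinate n i) = t i"
proof -
  have k: "2 \<le> n - i div 2" "n - i div 2 \<le> n" "n - (n - i div 2) = i div 2"
    using assms by auto
  show ?thesis
    using caracol_flow_simps(1,3)[OF k(1,2), of w t] k(3)
    by (auto simp: caracol_coordinate_def)
qed

lemma sum_reverse_index: "(\<Sum>i=2..n. f (n - i)) = (\<Sum>l<n - 1. f l)" for f :: "nat \<Rightarrow> real"
  by (rule sum.reindex_bij_witness[of _ "\<lambda>l. n - l" "\<lambda>i. n - i"]) auto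

lemma caracol_flow_in_flow_space:
  assumes n: "n \<ge> 1" and a: "length a = n + 1"
    and w: "\<And>k. 1 \<le> k \<Longrightarrow> k \<le> n + 1 \<Longrightarrow> w k = real_of_int (a ! (k - 1))"
  shows "caracol_flow n w t \<in> flow_space (caracol n) a"
proof -
  let ?f = "caracol_flow n w t"
  have 1: "net_flow (caracol n) ?f 1 = w 1"
  proof -
    have "(\<Sum>i=2..n. ?f (1, i)) = (\<Sum>i=2..n. t (2 * (n - i) + 1))"
      by (intro sum.cong) (auto simp: caracol_flow_simps(1)[simplified])
    then show ?thesis
      using n sum_reverse_index[of "\<lambda>i. t (2 * i + 1)" n] caracol_flow_simps(2)[OF n, of w t]
      by (simp add: net_flow_caracol(1)[OF n, simplified])
  qed
  have 2: "net_flow (caracol n) ?f k = w k" if "2 \<le> k" "k \<le> n + 1" for k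
  proof -
    have "?f (k, n + 2) = w k + (if 3 \<le> k then t (2 * (n + 1 - k)) else 0) + ?f (1, k)
       - (if k \<le> n then t (2 * (n - k)) else 0)"
      using caracol_flow_simps(4) that .
    moreover have "?f (k, k + 1) = t (2 * (n - k))" if "k \<le> n"
      using caracol_flow_simps(3) \<open>2 \<le> k\<close> that .
    moreover have "?f (k - 1, k) = t (2 * (n + 1 - k))" if "3 \<le> k"
      using caracol_flow_simps(3)[of "k - 1" n w t] that \<open>k \<le> n + 1\<close> by simp
    ultimately show ?thesis
      unfolding net_flow_caracol(2)[OF n that] by auto
  qed
  have net: "net_flow (caracol n) ?f k = real_of_int (a ! (k - 1))" if "1 \<le> k" "k \<le> n + 1" for k
    using 1 2[of k] w[of k] that by (cases "k = 1") auto
  \<comment> \<open>The sink is the one vertex whose equation is not built into the construction;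
    its net flow is minus the sum of the others.\<close>
  have "(\<Sum>k\<in>{1..n + 2}. net_flow (caracol n) ?f k) = 0"
    by (rule sum_net_flow_eq_0) (auto simp: caracol_def)
  then have "net_flow (caracol n) ?f (n + 2) = - (\<Sum>k=1..n + 1. real_of_int (a ! (k - 1)))"
    using net by simp
  also have "(\<Sum>k=1..n + 1. real_of_int (a ! (k - 1))) = (\<Sum>k<n + 1. real_of_int (a ! k))"
    by (rule sum.reindex_bij_witness[of _ Suc "\<lambda>k. k - 1"]) auto
  also have "\<dots> = real_of_int (sum_list a)"
    by (simp add: sum_list_sum_nth a atLeast0LessThan)
  finally have "net_flow (caracol n) ?f k = real_of_int ((a @ [- sum_list a]) ! (k - 1))"
    if "k \<in> {1..length a + 1}" for k
    using net that a by (cases "k = n + 2") (auto simp: nth_append)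
  moreover have "?f \<in> edge_space (caracol n)"
    using n by (auto simp: edge_space_def caracol_eq caracol_flow_def Let_def)
  ultimately show ?thesis by (simp add: flow_space_def)
qed

text \<open>Conservation at vertex 1 forces the flow on \<open>(1, n + 1)\<close> to vanish, and
  then conservation at each \<open>k\<close> forces the flow on \<open>(k, n + 2)\<close> to
  vanish.\<close>

lemma caracol_flow_unique:
  assumes n: "n \<ge> 1" and f: "f \<in> flow_space (caracol n) (replicate (n + 1) 0)"
    and coord: "\<And>i. i < 2 * (n - 1) \<Longrightarrow> f (caracol_coordinate n i) = 0"
  shows "f = (\<lambda>e. 0)"
proof -
  have net: "net_flow (caracol n) f k = 0" if "1 \<le> k" "k \<le> n + 2" for k
    using f that unfolding flow_space_zero_iff by simp
  have x: "f (1, k) = 0" if "2 \<le> k" "k \<le> n" for k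
    using coord[of "2 * (n - k) + 1"] that by (simp add: caracol_coordinate_def)
  have p: "f (k, k + 1) = 0" if "2 \<le> k" "k \<le> n" for k
    using coord[of "2 * (n - k)"] that by (simp add: caracol_coordinate_def)
  have "f (1, n + 1) = 0"
    using net[of 1] n x unfolding net_flow_caracol(1)[OF n] by simp
  with x have x': "f (1, k) = 0" if "2 \<le> k" "k \<le> n + 1" for k
    using that by (cases "k = n + 1") auto
  have y: "f (k, n + 2) = 0" if "2 \<le> k" "k \<le> n + 1" for k
    using net[of k] that x'[OF that] p[of k] p[of "k - 1"] unfolding net_flow_caracol(2)[OF n that]
    by (auto split: if_splits)
  show ?thesis
  proof
    fix e
    show "f e = 0"
    proof (cases "e \<in> caracol n")
      case True
      then show ?thesis using x' p y unfolding caracol_eq[OF n] by auto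
    next
      case False
      moreover have "f \<in> edge_space (caracol n)" using f by (simp add: flow_space_def)
      ultimately show ?thesis by (cases e) (simp add: edge_space_def)
    qed
  qed
qed

text \<open>Nonnegativity on \<open>(1, n + 1)\<close> is the bound on the total flow out of vertex
  1, and on \<open>(k, n + 2)\<close> with \<open>k \<le> n\<close> it is the upper bound for the
  flow on \<open>(k, k + 1)\<close>. The index \<open>j\<close> of the region is
  \<open>n - k\<close>.\<close>

lemma caracol_flow_in_polytope_iff:
  assumes n: "n \<ge> 1" and pos: "0 < b" "0 < c" and t: "t \<in> {..<2 * (n - 1)} \<rightarrow>\<^sub>E UNIV"
    and w: "w 1 = a" "w 2 = b" "\<And>k. 3 \<le> k \<Longrightarrow> k \<le> n + 1 \<Longrightarrow> w k = c"
  shows "(\<forall>e\<in>caracol n. 0 \<le> caracol_flow n w t e) \<longleftrightarrow> t \<in> caracol_region c (n - 1) a b"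
proof -
  let ?f = "caracol_flow n w t"
  have ball: "(\<forall>k\<in>{2..n}. P (n - k)) \<longleftrightarrow> (\<forall>j<n - 1. P j)" for P
  proof
    assume *: "\<forall>k\<in>{2..n}. P (n - k)"
    show "\<forall>j<n - 1. P j"
    proof (intro allI impI)
      fix j assume "j < n - 1"
      then show "P j" using *[rule_format, of "n - j"] by auto
    qed
  qed auto
  have insert: "{2..n + 1} = insert (n + 1) {2..n}" using n by auto
  \<comment> \<open>No path edge counted among the coordinates enters vertex 2, so its inflow from
    elsewhere is its net flow \<open>b\<close>; it has the last index, \<open>n - 2\<close>.\<close>
  have q: "w k + (if 3 \<le> k then t (2 * (n + 1 - k)) else 0)
      = (if (n - k) + 1 = n - 1 then b else t (2 * (n - k) + 2) + c)" if "k \<in> {2..n}" for k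
  proof (cases "k = 2")
    case False
    then have "3 \<le> k" "k \<le> n + 1" "2 * (n + 1 - k) = 2 * (n - k) + 2" "n - k + 1 \<noteq> n - 1"
      using that by auto
    then show ?thesis using w(3)[of k] by (simp only: if_True if_False simp_thms add.commute)
  next
    case True
    then have "n - k + 1 = n - 1" using that by auto
    then show ?thesis using True w(2) by simp
  qed
  \<comment> \<open>Nothing but the sink edge leaves vertex \<open>n + 1\<close>, and it carries the
    sum of a positive net flow and nonnegative inflows.\<close>
  have last: "0 \<le> ?f (n + 1, n + 2)" if "0 \<le> ?f (1, n + 1)" "\<forall>k\<in>{2..n}. 0 \<le> t (2 * (n - k))"
  proof -
    have "0 \<le> w (n + 1) + (if 3 \<le> n + 1 then t (2 * (n + 1 - (n + 1))) else 0)"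
    proof (cases "n = 1")
      case True
      then show ?thesis using w(2) pos by (simp add: numeral_2_eq_2)
    next
      case False
      then show ?thesis using w(3)[of "n + 1"] pos that(2)[rule_format, of n] n by auto
    qed
    then show ?thesis
      using caracol_flow_simps(4)[of "n + 1" n w t] that(1) n by simp
  qed
  have "(\<forall>e\<in>caracol n. 0 \<le> ?f e) \<longleftrightarrow> (\<forall>k\<in>{2..n + 1}. 0 \<le> ?f (1, k)) \<and>
      (\<forall>k\<in>{2..n}. 0 \<le> ?f (k, k + 1)) \<and> (\<forall>k\<in>{2..n + 1}. 0 \<le> ?f (k, n + 2))"
    unfolding caracol_eq[OF n] by blast
  also have "\<dots> \<longleftrightarrow> 0 \<le> ?f (1, n + 1) \<and> (\<forall>k\<in>{2..n}. 0 \<le> ?f (k, k + 1) \<and> 0 \<le> ?f (1, k) \<and> 0 \<le> ?f (k, n + 2))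
      \<and> 0 \<le> ?f (n + 1, n + 2)"
    unfolding insert by blast
  also have "\<dots> \<longleftrightarrow> 0 \<le> ?f (1, n + 1) \<and> (\<forall>k\<in>{2..n}. 0 \<le> t (2 * (n - k)) \<and> 0 \<le> t (2 * (n - k) + 1) \<and>
      t (2 * (n - k)) \<le> (if (n - k) + 1 = n - 1 then b else t (2 * (n - k) + 2) + c) + t (2 * (n - k) + 1))
      \<and> 0 \<le> ?f (n + 1, n + 2)"
  proof -
    have "(0 \<le> ?f (k, k + 1) \<and> 0 \<le> ?f (1, k) \<and> 0 \<le> ?f (k, n + 2)) \<longleftrightarrow>
      (0 \<le> t (2 * (n - k)) \<and> 0 \<le> t (2 * (n - k) + 1) \<and>
      t (2 * (n - k)) \<le> (if (n - k) + 1 = n - 1 then b else t (2 * (n - k) + 2) + c) + t (2 * (n - k) + 1))"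
      if k: "k \<in> {2..n}" for k
      using k caracol_flow_simps(1,3,4)[of k n w t] q[OF k] by auto
    then show ?thesis by blast
  qed
  also have "\<dots> \<longleftrightarrow> (\<Sum>l<n - 1. t (2 * l + 1)) \<le> a \<and> (\<forall>k\<in>{2..n}. 0 \<le> t (2 * (n - k)) \<and> 0 \<le> t (2 * (n - k) + 1) \<and>
      t (2 * (n - k)) \<le> (if (n - k) + 1 = n - 1 then b else t (2 * (n - k) + 2) + c) + t (2 * (n - k) + 1))"
    using last caracol_flow_simps(2)[OF n, of w t] w(1) by auto
  also have "\<dots> \<longleftrightarrow> t \<in> caracol_region c (n - 1) a b"
    unfolding caracol_region_def
    using t ball[of "\<lambda>j. 0 \<le> t (2 * j) \<and> 0 \<le> t (2 * j + 1) \<and>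
       t (2 * j) \<le> (if j + 1 = n - 1 then b else t (2 * j + 2) + c) + t (2 * j + 1)"]
    by blast
  finally show ?thesis .
qed

section \<open>Volume of the caracol polytope from its origin, lattice basis and coordinates\<close>

theorem proposition5p8:
  fixes n :: nat and a b c :: int
  assumes "n \<ge> 1" and "a > 0" and "b > 0" and "c > 0"
  shows "flow_polytope_vol (caracol n) ([a, b] @ replicate (n - 1) c)
       = catalan (n - 1) * real_of_int a ^ (n - 1) * (real_of_int a + real n * real_of_int b)
         * (real_of_int a + real_of_int b + (real n - 1) * real_of_int c) powi (int n - 2)"
proof -
  note n = \<open>n \<ge> 1\<close>
  define m where "m = n - 1"
  define as where "as = [a, b] @ replicate (n - 1) c"
  define w where "w k = real_of_int (as ! (k - 1))" for k
  \<comment> \<open>The fundamental cycles: zero net flow and one coordinate equal to 1. The flow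
    \<open>p\<close> with all coordinates 0 serves as the origin.\<close>
  define v where "v i = caracol_flow n (\<lambda>_. 0) (\<lambda>j. of_bool (j = i))" for i
  define p where "p = caracol_flow n w (\<lambda>_. 0)"
  have len: "length as = n + 1" unfolding as_def using n by simp
  have dim: "card (caracol n) - length as = 2 * m"
    using n by (simp add: card_caracol len m_def)
  have w12: "w 1 = a" "w 2 = b" by (simp_all add: w_def as_def)
  have w3: "w k = c" if "3 \<le> k" "k \<le> n + 1" for k
  proof -
    have "k - 1 = Suc (Suc (k - 3))" "k - 3 < n - 1" using that by auto
    then show ?thesis by (simp add: w_def as_def)
  qed
  have flow_in: "caracol_flow n w t \<in> flow_space (caracol n) as" for t
    by (rule caracol_flow_in_flow_space[OF n len]) (simp add: w_def)
  have p: "p \<in> flow_space (caracol n) as"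
    unfolding p_def by (rule flow_in)
  have v_flow: "v i \<in> flow_space (caracol n) (replicate (n + 1) 0)" for i
    unfolding v_def
    by (rule caracol_flow_in_flow_space[OF n]) (auto simp: nth_replicate simp del: replicate_Suc)
  have v_Ints: "v i e \<in> \<int>" for i e
    unfolding v_def caracol_flow_def Let_def
    by (cases e) (auto intro!: Ints_add Ints_diff Ints_sum Ints_minus)
  have v_coord: "v i (caracol_coordinate n j) = of_bool (j = i)" if "j < 2 * m" for i j
    using that by (simp add: v_def caracol_flow_coordinate m_def)
  \<comment> \<open>Both sides have the same net flow and the same coordinates, so uniqueness
    identifies them.\<close>
  have flow: "(\<lambda>e. p e + (\<Sum>i<2 * m. t i * v i e)) = caracol_flow n w t" (is "?f = ?g") for t
  proof -
    have "?f \<in> flow_space (caracol n) as"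
      using p flow_space_zero_sum[of "{..<2 * m}" v "caracol n" "n + 1" t] v_flow len
      by (intro flow_space_plus_zero) auto
    then have "(\<lambda>e. ?f e - ?g e) \<in> flow_space (caracol n) (replicate (n + 1) 0)"
      using flow_space_diff[of ?f "caracol n" as ?g] flow_in len by simp
    then have "(\<lambda>e. ?f e - ?g e) = (\<lambda>e. 0)"
    proof (rule caracol_flow_unique[OF n])
      fix i assume i: "i < 2 * (n - 1)"
      then have "(\<Sum>j<2 * m. t j * v j (caracol_coordinate n i)) = t i"
        by (simp add: v_coord m_def of_bool_def if_distrib[of "\<lambda>z. _ * z"] cong: if_cong)
      with i show "?f (caracol_coordinate n i) - ?g (caracol_coordinate n i) = 0"
        by (simp add: p_def caracol_flow_coordinate)
    qed
    then show ?thesis by (simp add: fun_eq_iff)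
  qed
  have region: "{t \<in> {..<2 * m} \<rightarrow>\<^sub>E UNIV. (\<lambda>e. p e + (\<Sum>i<2 * m. t i * v i e)) \<in> flow_polytope (caracol n) as}
      = caracol_region c m a b"
  proof -
    have "caracol_flow n w t \<in> flow_polytope (caracol n) as \<longleftrightarrow> t \<in> caracol_region c m a b"
      if "t \<in> {..<2 * m} \<rightarrow>\<^sub>E UNIV" for t
      using caracol_flow_in_polytope_iff[OF n _ _ that[unfolded m_def] w12 w3] assms flow_in
      by (simp add: flow_polytope_def m_def)
    moreover have "caracol_region c m a b \<subseteq> {..<2 * m} \<rightarrow>\<^sub>E UNIV"
      by (auto simp: caracol_region_def)
    ultimately show ?thesis
      unfolding flow by blast
  qed
  have "lattice_volume (caracol n) as (flow_polytope (caracol n) as)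
      = measure (PiM {..<2 * m} (\<lambda>_. lborel)) (caracol_region c m a b)"
  proof (subst lattice_volume_eq_coordinates[OF dim[symmetric] p,
        where w = v and g = "caracol_coordinate n"]; (unfold region)?)
    show "v i \<in> flow_lattice (caracol n) (length as)" for i
      using v_flow v_Ints by (simp add: flow_lattice_def len del: replicate_Suc)
  next
    show "v i (caracol_coordinate n j) = of_bool (i = j)" if "j < 2 * m" for i j
      using v_coord[OF that] by auto
  next
    show "caracol_coordinate n j \<in> caracol n" if "j < 2 * m" for j
      using that n by (simp add: caracol_coordinate_in m_def)
  next
    show "x = (\<lambda>e. 0)" if "x \<in> flow_space (caracol n) (replicate (length as) 0)"
      "\<And>i. i < 2 * m \<Longrightarrow> x (caracol_coordinate n i) = 0" for x
      using caracol_flow_unique[OF n] that unfolding len m_def by blast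
  next
    show "caracol_region c m a b \<in> sets (PiM {..<2 * m} (\<lambda>_. lborel))"
      by (rule sets_caracol_region)
  qed simp
  also have "\<dots> = caracol_region_volume c m a b"
    using emeasure_caracol_region[of c a b m] assms
    by (simp add: measure_def caracol_region_volume_nonneg)
  finally have "flow_polytope_vol (caracol n) as = fact (2 * m) / (fact m * fact (m + 1)) *
      (real_of_int a ^ m * (real_of_int a + (real m + 1) * real_of_int b) *
        (real_of_int a + real_of_int b + real m * real_of_int c) powi (int m - 1))"
    unfolding flow_polytope_vol_def dim caracol_region_volume_def
    by (simp only: times_divide_eq_right times_divide_eq_left)
  \<comment> \<open>The normalizing factor \<open>(2m)!\<close> and the denominator
    \<open>m! (m + 1)!\<close> combine to the binomial coefficient of \<open>2m\<close> over
    \<open>m\<close> divided by \<open>m + 1\<close>.\<close>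
  also have "fact (2 * m) / (fact m * fact (m + 1)) = catalan m"
    by (simp add: catalan_def binomial_fact mult_2 add.commute)
  finally have vol: "flow_polytope_vol (caracol n) as = catalan m *
      (real_of_int a ^ m * (real_of_int a + (real m + 1) * real_of_int b) *
        (real_of_int a + real_of_int b + real m * real_of_int c) powi (int m - 1))" .
  have n': "real n - 1 = real m" "real n = real m + 1" "int n - 2 = int m - 1"
    using n by (auto simp: m_def)
  show ?thesis
    using vol by (simp only: as_def m_def[symmetric] n' add_diff_cancel_right' mult.assoc)
qed

end
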